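(* For every graph $G$, $\alpha'_g(G)\ge \frac{2}{3}\alpha'(G)$.
   Context: Graphs are finite and simple. $\alpha'(G)$ denotes the maximum size of a matching in $G$. The matching game on a graph $G$: two players, Max and Min, alternately add edges of $G$ to a set of chosen edges that must always remain a matching; the game ends when the chosen edges form a maximal matching of $G$ (no further edge can be added). Max wants the final matching to be large, Min wants it to be small. $\alpha'_g(G)$ denotes the size of the final matching under optimal play when Max moves first. *)

theory Defs
  imports Complex_Main
begin

definition finite_simple_graph :: "'a set \<Rightarrow> 'a set set \<Rightarrow> bool" where
  "finite_simple_graph V E \<longleftrightarrow> finite V \<and> (\<forall>e\<in>E. e \<subseteq> V \<and> card e = 2)"

(* The remaining notions depend on a graph only through its edge set. *)

definition matching :: "'a set set \<Rightarrow> 'a set set \<Rightarrow> bool" where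
  "matching E M \<longleftrightarrow> M \<subseteq> E \<and> pairwise disjnt M"

definition matching_number :: "'a set set \<Rightarrow> nat" where
  "matching_number E = Max (card ` {M. matching E M})"

datatype player = Maximizer | Minimizer

definition legal_moves :: "'a set set \<Rightarrow> 'a set set \<Rightarrow> 'a set set" where
  "legal_moves E M = {e \<in> E - M. matching E (insert e M)}"

(* Size of the final matching under optimal play (backward induction) from the position in
   which M has been chosen and player p is to move.  The game ends exactly when M is maximal.
   The test for infinite E is only there to make the recursion terminate unconditionally. *)

function game_value :: "'a set set \<Rightarrow> player \<Rightarrow> 'a set set \<Rightarrow> nat" where
  "game_value E p M =
    (if infinite E \<or> legal_moves E M = {} then card M
     else case p of
       Maximizer \<Rightarrow> Max ((\<lambda>e. game_value E Minimizer (insert e M)) ` legal_moves E M)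
     | Minimizer \<Rightarrow> Min ((\<lambda>e. game_value E Maximizer (insert e M)) ` legal_moves E M))"
  by pat_completeness auto
termination
proof (relation "measure (\<lambda>(E, p, M). card (E - M))")
  have *: "card (E - insert e M) < card (E - M)"
    if "\<not> (infinite E \<or> legal_moves E M = {})" "e \<in> legal_moves E M" for E M :: "'a set set" and e
    using that by (intro psubset_card_mono) (auto simp: legal_moves_def)
  then show
    "\<And>E p M e. \<not> (infinite E \<or> legal_moves E M = {}) \<Longrightarrow> p = Maximizer \<Longrightarrow> e \<in> legal_moves E M \<Longrightarrow>
      ((E :: 'a set set, Minimizer, insert e M), (E, p, M)) \<in> measure (\<lambda>(E, p, M). card (E - M))"
    "\<And>E p M e. \<not> (infinite E \<or> legal_moves E M = {}) \<Longrightarrow> p = Minimizer \<Longrightarrow> e \<in> legal_moves E M \<Longrightarrow>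
      ((E :: 'a set set, Maximizer, insert e M), (E, p, M)) \<in> measure (\<lambda>(E, p, M). card (E - M))"
    by simp_all
qed simp

declare game_value.simps [simp del]

definition game_matching_number :: "'a set set \<Rightarrow> nat" where
  "game_matching_number E = game_value E Maximizer {}"

end

(* Max always plays an edge of some fixed extension N of the current matching.  Any reply of Min
   meets at most two other edges of N, so a round adds two edges at the cost of at most three
   edges of N. *)
theory Submission
  imports Defs
begin

lemma finite_legal_moves: "finite E \<Longrightarrow> finite (legal_moves E M)"
  by (simp add: legal_moves_def)

lemma matching_subset: "matching E M \<Longrightarrow> N \<subseteq> M \<Longrightarrow> matching E N"
  unfolding matching_def by (meson order_trans pairwise_subset)

lemma card_insert_le_Suc: "card (insert x A) \<le> Suc (card A)"
  by (cases "finite A") (auto simp: card_insert_if)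

text \<open>Each member of \<open>N\<close> that meets \<open>f\<close> selects a vertex of
  \<open>f\<close> in it; pairwise disjoint members cannot select the same vertex.\<close>

lemma card_meeting_le:
  assumes "pairwise disjnt N" "finite f"
  shows "card {n \<in> N. \<not> disjnt n f} \<le> card f"
proof (rule card_inj_on_le)
  let ?v = "\<lambda>n. SOME x. x \<in> n \<inter> f"
  have v: "?v n \<in> n \<inter> f" if "n \<in> {n \<in> N. \<not> disjnt n f}" for n
  proof (rule someI_ex)
    show "\<exists>x. x \<in> n \<inter> f" using that by (auto simp: disjnt_def)
  qed
  show "inj_on ?v {n \<in> N. \<not> disjnt n f}"
  proof (rule inj_onI)
    fix m n
    assume mn: "m \<in> {n \<in> N. \<not> disjnt n f}" "n \<in> {n \<in> N. \<not> disjnt n f}" and "?v m = ?v n"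
    then have "\<not> disjnt m n" using v[OF mn(1)] v[OF mn(2)] by (auto simp: disjnt_iff)
    then show "m = n" using assms(1) mn by (auto simp: pairwise_def)
  qed
  show "?v ` {n \<in> N. \<not> disjnt n f} \<subseteq> f" using v by blast
qed (rule assms)

lemma game_value_stuck: "legal_moves E M = {} \<Longrightarrow> game_value E p M = card M"
  by (subst game_value.simps) simp

lemma game_value_Maximizer_ge:
  assumes "finite E" "e \<in> legal_moves E M"
  shows "game_value E Minimizer (insert e M) \<le> game_value E Maximizer M"
  using assms by (subst (2) game_value.simps) (auto intro!: Max_ge finite_legal_moves)

text \<open>Finiteness makes the minimum attained, so a lower bound on the value only has to deal
  with this one optimal reply.\<close>

lemma game_value_Minimizer_attained:
  assumes "finite E" "legal_moves E M \<noteq> {}"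
  obtains f where "f \<in> legal_moves E M"
    "game_value E Minimizer M = game_value E Maximizer (insert f M)"
proof -
  let ?A = "(\<lambda>f. game_value E Maximizer (insert f M)) ` legal_moves E M"
  have "game_value E Minimizer M = Min ?A"
    using assms by (subst game_value.simps) auto
  moreover have "Min ?A \<in> ?A"
    using assms by (intro Min_in) (auto simp: finite_legal_moves)
  ultimately show thesis using that by auto
qed

lemma card_insert_legal_move:
  assumes "finite E" "matching E M" "e \<in> legal_moves E M"
  shows "card (insert e M) = Suc (card M)"
proof -
  have "finite M" using assms by (auto simp: matching_def intro: finite_subset)
  then show ?thesis using assms by (simp add: legal_moves_def)
qed

text \<open>Moves only add edges. This settles positions where nothing of the extension is
  left.\<close>

lemma game_value_ge_card:
  "matching E M \<Longrightarrow> card M \<le> game_value E p M"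
proof (induction E p M rule: game_value.induct)
  case (1 E p M)
  show ?case
  proof (cases "infinite E \<or> legal_moves E M = {}")
    case True
    then show ?thesis by (subst game_value.simps) simp
  next
    case False
    then have fin: "finite E" and ne: "legal_moves E M \<noteq> {}" by auto
    have step: "card M \<le> card (insert e M)" "matching E (insert e M)" if "e \<in> legal_moves E M" for e
      using card_insert_legal_move[OF fin "1.prems" that] that by (auto simp: legal_moves_def)
    show ?thesis
    proof (cases p)
      case Maximizer
      obtain e where e: "e \<in> legal_moves E M" using ne by auto
      show ?thesis
        using "1.IH"(1)[OF False Maximizer e] step[OF e] game_value_Maximizer_ge[OF fin e] Maximizer
        by simp
    next
      case Minimizer
      obtain e where e: "e \<in> legal_moves E M"
        "game_value E Minimizer M = game_value E Maximizer (insert e M)"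
        using game_value_Minimizer_attained[OF fin ne] .
      show ?thesis using "1.IH"(2)[OF False Minimizer e(1)] step[OF e(1)] e(2) Minimizer by simp
    qed
  qed
qed

text \<open>The weights 3 and 2 make the left side non-decreasing over a full round: two new edges
  in \<open>M\<close> gain 6, and at most three edges lost from \<open>N\<close> cost 6.
  \<open>N\<close> is arbitrary rather than maximum so that the induction can pass to what survives
  of it.\<close>

lemma game_value_Maximizer_extension:
  assumes "finite E" "\<And>e. e \<in> E \<Longrightarrow> card e = 2"
    and "matching E (M \<union> N)" "M \<inter> N = {}"
  shows "3 * card M + 2 * card N \<le> 3 * game_value E Maximizer M"
  using assms(3,4)
proof (induction "card N" arbitrary: M N rule: less_induct)
  case less
  have M: "matching E M" using less.prems(1) by (rule matching_subset) simp
  have finN: "finite N" using less.prems(1) assms(1) by (auto simp: matching_def intro: finite_subset)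
  show ?case
  proof (cases "N = {}")
    case True
    then show ?thesis using game_value_ge_card[OF M] by simp
  next
    case False
    then obtain e where e: "e \<in> N" by auto
    let ?M = "insert e M"
    have M': "matching E ?M" using less.prems(1) by (rule matching_subset) (use e in auto)
    have le: "e \<in> legal_moves E M"
      using M' e less.prems by (auto simp: legal_moves_def matching_def)
    have cM: "card ?M = Suc (card M)" using card_insert_legal_move[OF assms(1) M le] .
    have ge: "game_value E Minimizer ?M \<le> game_value E Maximizer M"
      using game_value_Maximizer_ge[OF assms(1) le] .
    show ?thesis
    proof (cases "legal_moves E ?M = {}")
      case True
      \<comment> \<open>Any other edge of \<open>N\<close> would still be playable, so the game can
        stop here only if \<open>N\<close> was just \<open>e\<close>; the final size
        \<open>card M + 1\<close> then suffices, since 3 exceeds 2.\<close>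
      have "n = e" if n: "n \<in> N" for n
      proof (rule ccontr)
        assume "n \<noteq> e"
        moreover have "matching E (insert n ?M)"
          using less.prems(1) by (rule matching_subset) (use e n in blast)
        ultimately have "n \<in> legal_moves E ?M"
          using n less.prems by (auto simp: legal_moves_def matching_def)
        then show False using True by simp
      qed
      then have "N = {e}" using e by blast
      then show ?thesis using ge cM game_value_stuck[OF True, of Minimizer] by simp
    next
      case ne: False
      obtain f where f: "f \<in> legal_moves E ?M"
        "game_value E Minimizer ?M = game_value E Maximizer (insert f ?M)"
        using game_value_Minimizer_attained[OF assms(1) ne] .
      \<comment> \<open>The part of the extension that survives the round. The edge \<open>e\<close>
        is removed explicitly because it is disjoint from the legal reply \<open>f\<close>.\<close>
      let ?N = "{n \<in> N - {e}. disjnt n f}"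
      have fE: "f \<in> E" "matching E (insert f ?M)" using f(1) by (auto simp: legal_moves_def)
      have f2: "card f = 2" using assms(2) fE(1) .
      have "N = insert e (?N \<union> {n \<in> N. \<not> disjnt n f})" using e by auto
      then have "card N \<le> Suc (card (?N \<union> {n \<in> N. \<not> disjnt n f}))"
        using card_insert_le_Suc[of e "?N \<union> {n \<in> N. \<not> disjnt n f}"] by argo
      also have "\<dots> \<le> Suc (card ?N + card {n \<in> N. \<not> disjnt n f})"
        by (simp add: card_Un_le)
      also have "card {n \<in> N. \<not> disjnt n f} \<le> 2"
      proof -
        have "pairwise disjnt N"
          using matching_subset[OF less.prems(1)] by (simp add: matching_def)
        moreover have "finite f" using f2 by (simp add: card_ge_0_finite)
        ultimately show ?thesis using card_meeting_le[of N f] f2 by simp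
      qed
      finally have cN: "card N \<le> card ?N + 3" by simp
      have dec: "card ?N < card N" using e finN by (intro psubset_card_mono) auto
      \<comment> \<open>Survivors avoid \<open>e\<close> because both lie in the matching
        \<open>N\<close>, and avoid \<open>f\<close> by their choice.\<close>
      have "matching E (insert f ?M \<union> ?N)"
        using fE(2) less.prems(1) e unfolding matching_def pairwise_def
        by (auto simp: disjnt_sym)
      \<comment> \<open>The reply \<open>f\<close> may itself belong to \<open>N\<close>; being
        nonempty, it is not disjoint from itself and so is no survivor.\<close>
      moreover have "insert f ?M \<inter> ?N = {}"
        using less.prems(2) f2 by auto
      ultimately have "3 * card (insert f ?M) + 2 * card ?N \<le> 3 * game_value E Maximizer (insert f ?M)"
        using less.hyps[OF dec] by blast
      then show ?thesis
        using card_insert_legal_move[OF assms(1) M' f(1)] cM cN ge f(2) by simp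
    qed
  qed
qed

theorem theorem3p4:
  fixes V :: "'a set" and E :: "'a set set"
  assumes "finite_simple_graph V E"
  shows "real (game_matching_number E) \<ge> 2 / 3 * real (matching_number E)"
proof -
  have fin: "finite E" and two: "\<And>e. e \<in> E \<Longrightarrow> card e = 2"
    using assms by (auto simp: finite_simple_graph_def intro: finite_subset[of E "Pow V"])
  have "finite {N. matching E N}"
    using fin by (auto simp: matching_def intro: finite_subset[of _ "Pow E"])
  moreover have "matching E {}" by (simp add: matching_def)
  ultimately have "matching_number E \<in> card ` {N. matching E N}"
    unfolding matching_number_def by (intro Max_in) auto
  then obtain N where "matching E N" "matching_number E = card N" by auto
  \<comment> \<open>At the start nothing is chosen, and a maximum matching serves as the
    extension.\<close>
  then have "2 * matching_number E \<le> 3 * game_matching_number E"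
    using game_value_Maximizer_extension[OF fin two, of "{}" N]
    by (simp add: game_matching_number_def)
  then show ?thesis by linarith
qed

end
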